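(* Let $0<\mu<L$, let $K\ge2$ be an integer, and let $(\gamma,\beta)\in\Omega_{K\text{-}\circ}(\mathcal F_{\mu,L})$. There exist $\kappa_P>0$ and $\rho_D<1$ such that the following holds. Let $\delta_0,\delta_1\in\mathbb R^2$, and let $(\delta_{\gamma_t})_{t\in\mathbb N}$, $(\delta_{\beta_t})_{t\in\mathbb N}$ be real sequences and $(\delta_{g_t})_{t\in\mathbb N}$ a sequence in $\mathbb R^2$. Let $(z_t)_{t\in\mathbb N}$ be generated by the heavy-ball recursion with time-varying parameters $\gamma_t=\gamma+\delta_{\gamma_t}$, $\beta_t=\beta+\delta_{\beta_t}$ and perturbed gradients $\hat g_t(z)=\nabla\psi(z)+\delta_{g_t}$, that is, $$z_{t+1}=z_t-\gamma_t\,\hat g_t(z_t)+\beta_t(z_t-z_{t-1}),\quad t\ge1,$$ initialized at $(z_0,z_1)=(x_0^\circ+\delta_0,\ x_1^\circ+\delta_1)$. If 1. $\sqrt{\|\delta_0\|^2+\|\delta_1\|^2}\le\kappa_P\, r_{\max}$, 2. for all $t\in\mathbb N$, $\left(\frac4\gamma+\mu\kappa_P r_{\max}\right)|\delta_{\gamma_t}|+\left(2+2\kappa_P r_{\max}\right)|\delta_{\beta_t}|\le\frac12(1-\rho_D)\kappa_P r_{\max}$, 3. for all $t\in\mathbb N$, $\frac4L\|\delta_{g_t}\|\le\frac12(1-\rho_D)\kappa_P r_{\max}$, then $(z_t)_{t\ge0}$ keeps cycling in a neighborhood of the roots-of-unity cycle: for all $t\ge 0$, $\|z_t-x^\circ_{t\bmod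 K}\|\le r_{\max}$ (and thus $z_t\in\mathcal V_{t\bmod K}$).
   Context: For $0<\mu\le L$, $\mathcal F_{\mu,L}$ is the set of continuously differentiable functions $f:\mathbb R^d\to\mathbb R$ ($d\ge1$ arbitrary) with $f(x)\le f(y)+\langle\nabla f(y),x-y\rangle+\frac L2\|x-y\|^2$ and $f(x)\ge f(y)+\langle\nabla f(y),x-y\rangle+\frac\mu2\|x-y\|^2$ for all $x,y$. For $\gamma,\beta\in\mathbb R$ and differentiable $f$, $\mathrm{HB}_{\gamma,\beta}(f)$ is the iteration $z_{t+1}=z_t-\gamma\nabla f(z_t)+\beta(z_t-z_{t-1})$, $t\ge1$, from initial points $z_0,z_1$. For $K$ points not all equal, $\mathrm{HB}_{\gamma,\beta}(f)$ cycles on $(x_0,\dots,x_{K-1})$ if the sequence initialized at $z_0=x_0,z_1=x_1$ satisfies $z_t=x_{t\bmod K}$ for all $t\ge0$. $\Omega_{\mathrm{cv}}(\mathcal Q_{\mu,L})=\{(\gamma,\beta):\beta\in(-1,1),\ 0<\gamma<\frac2L(1+\beta)\}$. With $\theta_K=2\pi/K$, $x_t^\circ=(\cos(t\theta_K),\sin(t\theta_K))^\top\in\mathbb R^2$, $t=0,\dots,K-1$, and $R$ is the rotation of $\mathbb R^2$ by angle $\theta_K$. $\Omega_{K\text{-}\circ}(\mathcal F_{\mu,L})$ is the set of $(\gamma,\beta)\in\Omega_{\mathrm{cv}}(\mathcal Q_{\mu,L})$ for which there is $f\in\mathcal F_{\mu,L}$ on $\mathbb R^2$ such that $\mathrm{HB}_{\gamma,\beta}(f)$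 cycles on $(x_0^\circ,\dots,x_{K-1}^\circ)$. $M=\frac{(1+\beta-\mu\gamma)I_2-R-\beta R^{-1}}{(L-\mu)\gamma}$ and $\psi(x)=\frac L2\|x\|^2-\frac{L-\mu}2 d\big(x,\mathrm{conv}\{Mx_t^\circ: 0\le t\le K-1\}\big)^2$ for $x\in\mathbb R^2$, where $d$ is Euclidean distance to a set. $\mathcal V_k$ ($0\le k\le K-1$) is the largest neighborhood of $x_k^\circ$ on which $\psi$ is quadratic with Hessian $\mu I_2$; formally, $\mathcal V_k$ is the set of all points having the same Euclidean projection onto $\mathrm{conv}\{Mx_t^\circ:0\le t\le K-1\}$ as $x_k^\circ$. $r_{\max}=-\Big\langle (I_2-M)x_0^\circ,\ \frac{M(x_1^\circ-x_0^\circ)}{\|M(x_1^\circ-x_0^\circ)\|}\Big\rangle$. *)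

theory Defs
  imports "HOL-Analysis.Analysis"
begin

text \<open>\<open>grad\<close> is meaningful only at points of differentiability, where the gradient is unique.\<close>

definition grad :: "('a::real_inner \<Rightarrow> real) \<Rightarrow> 'a \<Rightarrow> 'a" where
  "grad f x = (THE g. GDERIV f x :> g)"

definition smooth_strongly_convex :: "real \<Rightarrow> real \<Rightarrow> (real^'d \<Rightarrow> real) set" where
  "smooth_strongly_convex \<mu> L = {f.
     (\<forall>x. f differentiable (at x)) \<and> continuous_on UNIV (grad f) \<and>
     (\<forall>x y. f x \<le> f y + grad f y \<bullet> (x - y) + L / 2 * (norm (x - y))\<^sup>2) \<and>
     (\<forall>x y. f x \<ge> f y + grad f y \<bullet> (x - y) + \<mu> / 2 * (norm (x - y))\<^sup>2)}"

fun HB :: "real \<Rightarrow> real \<Rightarrow> (real^'d \<Rightarrow> real) \<Rightarrow> real^'d \<Rightarrow> real^'d \<Rightarrow> nat \<Rightarrow> real^'d" where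
  "HB \<gamma> \<beta> f z0 z1 0 = z0"
| "HB \<gamma> \<beta> f z0 z1 (Suc 0) = z1"
| "HB \<gamma> \<beta> f z0 z1 (Suc (Suc t)) =
     HB \<gamma> \<beta> f z0 z1 (Suc t) - \<gamma> *\<^sub>R grad f (HB \<gamma> \<beta> f z0 z1 (Suc t))
       + \<beta> *\<^sub>R (HB \<gamma> \<beta> f z0 z1 (Suc t) - HB \<gamma> \<beta> f z0 z1 t)"

text \<open>Only the values \<open>x 0, \<dots>, x (K - 1)\<close> of the sequence \<open>x\<close> matter.\<close>

definition HB_cycles_on ::
  "real \<Rightarrow> real \<Rightarrow> (real^'d \<Rightarrow> real) \<Rightarrow> nat \<Rightarrow> (nat \<Rightarrow> real^'d) \<Rightarrow> bool" where
  "HB_cycles_on \<gamma> \<beta> f K x \<longleftrightarrow>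
     (\<exists>i<K. \<exists>j<K. x i \<noteq> x j) \<and> (\<forall>t. HB \<gamma> \<beta> f (x 0) (x 1) t = x (t mod K))"

text \<open>The convergence region on quadratics with spectrum in \<open>[\<mu>, L]\<close> does not depend on \<open>\<mu>\<close>.\<close>

definition Omega_cv :: "real \<Rightarrow> (real \<times> real) set" where
  "Omega_cv L = {(\<gamma>, \<beta>). -1 < \<beta> \<and> \<beta> < 1 \<and> 0 < \<gamma> \<and> \<gamma> < 2 / L * (1 + \<beta>)}"

definition theta :: "nat \<Rightarrow> real" where
  "theta K = 2 * pi / real K"

definition root_pt :: "nat \<Rightarrow> nat \<Rightarrow> real^2" where
  "root_pt K t = vector [cos (real t * theta K), sin (real t * theta K)]"

definition rot :: "nat \<Rightarrow> real^2^2" where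
  "rot K = vector [vector [cos (theta K), - sin (theta K)],
                   vector [sin (theta K), cos (theta K)]]"

definition Omega_circ :: "nat \<Rightarrow> real \<Rightarrow> real \<Rightarrow> (real \<times> real) set" where
  "Omega_circ K \<mu> L = {(\<gamma>, \<beta>). (\<gamma>, \<beta>) \<in> Omega_cv L \<and>
     (\<exists>f \<in> smooth_strongly_convex \<mu> L. HB_cycles_on \<gamma> \<beta> f K (root_pt K))}"

definition M_mat :: "nat \<Rightarrow> real \<Rightarrow> real \<Rightarrow> real \<Rightarrow> real \<Rightarrow> real^2^2" where
  "M_mat K \<mu> L \<gamma> \<beta> = (1 / ((L - \<mu>) * \<gamma>)) *\<^sub>R
     ((1 + \<beta> - \<mu> * \<gamma>) *\<^sub>R mat 1 - rot K - \<beta> *\<^sub>R matrix_inv (rot K))"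

definition M_hull :: "nat \<Rightarrow> real \<Rightarrow> real \<Rightarrow> real \<Rightarrow> real \<Rightarrow> (real^2) set" where
  "M_hull K \<mu> L \<gamma> \<beta> = convex hull ((\<lambda>t. M_mat K \<mu> L \<gamma> \<beta> *v root_pt K t) ` {0..<K})"

definition psi :: "nat \<Rightarrow> real \<Rightarrow> real \<Rightarrow> real \<Rightarrow> real \<Rightarrow> real^2 \<Rightarrow> real" where
  "psi K \<mu> L \<gamma> \<beta> x =
     L / 2 * (norm x)\<^sup>2 - (L - \<mu>) / 2 * (infdist x (M_hull K \<mu> L \<gamma> \<beta>))\<^sup>2"

definition V_nbhd :: "nat \<Rightarrow> real \<Rightarrow> real \<Rightarrow> real \<Rightarrow> real \<Rightarrow> nat \<Rightarrow> (real^2) set" where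
  "V_nbhd K \<mu> L \<gamma> \<beta> k =
     {x. closest_point (M_hull K \<mu> L \<gamma> \<beta>) x = closest_point (M_hull K \<mu> L \<gamma> \<beta>) (root_pt K k)}"

definition r_max :: "nat \<Rightarrow> real \<Rightarrow> real \<Rightarrow> real \<Rightarrow> real \<Rightarrow> real" where
  "r_max K \<mu> L \<gamma> \<beta> =
     (let M = M_mat K \<mu> L \<gamma> \<beta>; u = M *v (root_pt K 1 - root_pt K 0)
      in - (((mat 1 - M) *v root_pt K 0) \<bullet> ((1 / norm u) *\<^sub>R u)))"

text \<open>Heavy-ball recursion with step sizes \<open>\<gamma> + \<delta>\<gamma> t\<close>, momentum \<open>\<beta> + \<delta>\<beta> t\<close> and
  additive gradient errors \<open>\<delta>g t\<close>.\<close>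

definition perturbed_HB ::
  "real \<Rightarrow> real \<Rightarrow> (real^'d \<Rightarrow> real) \<Rightarrow> (nat \<Rightarrow> real) \<Rightarrow> (nat \<Rightarrow> real) \<Rightarrow> (nat \<Rightarrow> real^'d)
    \<Rightarrow> (nat \<Rightarrow> real^'d) \<Rightarrow> bool" where
  "perturbed_HB \<gamma> \<beta> f \<delta>\<gamma> \<delta>\<beta> \<delta>g z \<longleftrightarrow>
     (\<forall>t\<ge>1. z (t + 1) =
        z t - (\<gamma> + \<delta>\<gamma> t) *\<^sub>R (grad f (z t) + \<delta>g t) + (\<beta> + \<delta>\<beta> t) *\<^sub>R (z t - z (t - 1)))"

end

theory Submission
  imports Defs
begin

text \<open>Every point within \<open>r_max\<close> of a cycle point \<open>x\<close> projects onto the vertex \<open>M x\<close> of the hull.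
  There the gradient of \<open>\<psi>\<close> is affine with linear part \<open>\<mu>\<close>, so the deviations from the cycle
  obey \<open>e\<^sub>t\<^sub>+\<^sub>1 = (1 + \<beta> - \<mu> \<gamma>) e\<^sub>t - \<beta> e\<^sub>t\<^sub>-\<^sub>1 + w\<^sub>t\<close>. The homogeneous recursion is stable, hence
  contracts some norm on pairs of consecutive deviations, and a small ball of this norm is invariant
  when the errors \<open>w\<^sub>t\<close> are small. If \<open>r_max\<close> is
  negative, the hypotheses cannot be met.\<close>

section \<open>Gradients and projections onto convex sets\<close>

lemma grad_eq:
  assumes "GDERIV f x :> g"
  shows "grad f x = g"
  unfolding grad_def
proof (rule the_equality)
  show "GDERIV f x :> g" by (fact assms)
next
  fix h assume "GDERIV f x :> h"
  then have "(\<lambda>v. v \<bullet> h) = (\<lambda>v. v \<bullet> g)"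
    using assms has_derivative_unique unfolding gderiv_def by blast
  then have "(h - g) \<bullet> h = (h - g) \<bullet> g"
    by (rule fun_cong)
  then show "h = g"
    by (metis inner_diff_right inner_eq_zero_iff right_minus_eq)
qed

text \<open>Converse of \<open>closest_point_dot\<close>: expanding \<open>norm (x - y)\<close>
  squared around \<open>p\<close>, the obtuse angle gives the cross term the favourable
  sign.\<close>

lemma closest_point_eqI:
  fixes S :: "'a::euclidean_space set"
  assumes "convex S" and "closed S" and "p \<in> S"
    and "\<And>y. y \<in> S \<Longrightarrow> (x - p) \<bullet> (y - p) \<le> 0"
  shows "closest_point S x = p"
proof (rule closest_point_unique[symmetric])
  show "\<forall>y\<in>S. dist x p \<le> dist x y"
  proof
    fix y assume "y \<in> S"
    then have "(x - p) \<bullet> (y - p) \<le> 0" by (rule assms)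
    moreover have "(norm (x - y))\<^sup>2
        = (norm (x - p))\<^sup>2 + (norm (y - p))\<^sup>2 - 2 * ((x - p) \<bullet> (y - p))"
      by (simp add: power2_norm_eq_inner inner_diff inner_commute algebra_simps)
    ultimately have "(norm (x - p))\<^sup>2 \<le> (norm (x - y))\<^sup>2"
      using zero_le_power2[of "norm (y - p)"] by linarith
    then show "dist x p \<le> dist x y"
      by (simp add: dist_norm)
  qed
qed (use assms in auto)

text \<open>The first-order remainder lies between 0 and the square of \<open>norm (y - x)\<close>.
  For the upper bound, the projection of \<open>x\<close> competes with that of \<open>y\<close>;
  the lower bound is the obtuse angle at the projection of \<open>x\<close>.\<close>

lemma GDERIV_infdist_square:
  fixes S :: "'a::euclidean_space set"
  assumes "convex S" and "closed S" and "S \<noteq> {}"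
  shows "GDERIV (\<lambda>x. (infdist x S)\<^sup>2) x :> 2 *\<^sub>R (x - closest_point S x)"
  unfolding gderiv_def
proof (rule has_derivativeI_sandwich[of 1 _ _ _ _ "\<lambda>y. norm (y - x)"])
  let ?P = "closest_point S"
  have P: "infdist y S = norm (y - ?P y)" for y
    using assms by (simp add: infdist_eq_setdist setdist_closest_point dist_norm)
  show "bounded_linear (\<lambda>h. h \<bullet> 2 *\<^sub>R (x - ?P x))"
    by (rule bounded_linear_inner_left)
  have "((\<lambda>y. norm (y - x)) \<longlongrightarrow> norm (x - x)) (at x)"
    by (intro tendsto_intros)
  then show "((\<lambda>y. norm (y - x)) \<longlongrightarrow> 0) (at x)"
    by simp
  fix y assume "y \<noteq> x"
  have mem: "?P x \<in> S" "?P y \<in> S"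
    using assms by (auto simp: closest_point_in_set)
  let ?r = "(infdist y S)\<^sup>2 - (infdist x S)\<^sup>2 - (y - x) \<bullet> 2 *\<^sub>R (x - ?P x)"
  have "norm (y - ?P y) \<le> norm (y - ?P x)"
    using assms mem(1) closest_point_le[of S "?P x" y] by (simp add: dist_norm)
  then have "(infdist y S)\<^sup>2 \<le> (norm (y - ?P x))\<^sup>2"
    by (simp add: P)
  then have "?r \<le> (norm (y - x))\<^sup>2"
    by (simp add: P power2_norm_eq_inner inner_diff inner_commute algebra_simps)
  moreover have "0 \<le> ?r"
  proof -
    have "?r = (norm ((y - ?P y) - (x - ?P x)))\<^sup>2 - 2 * ((x - ?P x) \<bullet> (?P y - ?P x))"
      by (simp add: P power2_norm_eq_inner inner_diff inner_commute algebra_simps)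
    moreover have "(x - ?P x) \<bullet> (?P y - ?P x) \<le> 0"
      using assms mem(2) by (intro closest_point_dot)
    ultimately show ?thesis
      using zero_le_power2[of "norm ((y - ?P y) - (x - ?P x))"] by linarith
  qed
  ultimately show "norm ?r / norm (y - x) \<le> norm (y - x)"
    using \<open>y \<noteq> x\<close> by (simp add: field_simps power2_eq_square)
qed simp

section \<open>A norm contracted by the homogeneous recursion\<close>

text \<open>\<open>(1 + b) |x|\<^sup>2 - 2 a b \<langle>x, y\<rangle> + s |y|\<^sup>2\<close> is a Lyapunov function of
  \<open>(x, y) \<mapsto> (a x - b y, x)\<close>: its cross term is the one for which the decrease has no cross term, and
  \<open>s\<close> is halfway between the two values at which the decrease degenerates. Completing the square
  turns it into the squared norm of \<open>T (x, y)\<close>, up to the factor \<open>1 + b\<close>.\<close>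

lemma contracting_norm_exists:
  fixes a b :: real
  assumes "\<bar>b\<bar> < 1" and "\<bar>a\<bar> < 1 + b"
  obtains N :: "'a::euclidean_space \<times> 'a \<Rightarrow> real" and c C \<sigma> :: real
  where "0 < c" "0 < C" "\<sigma> < 1" "0 \<le> \<sigma>"
    "\<And>v w. N (v + w) \<le> N v + N w"
    "\<And>v. c * norm v \<le> N v" "\<And>v. N v \<le> C * norm v"
    "\<And>x y. N (a *\<^sub>R x - b *\<^sub>R y, x) \<le> \<sigma> * N (x, y)"
proof -
  \<comment> \<open>The decrease has coefficients proportional to
    \<open>(1 + b) - a^2 * (1 - b) - s\<close> and \<open>s - (1 + b) * b^2\<close>. Their sum is
    \<open>2 * D\<close>, so the midpoint makes both equal to \<open>D\<close>.\<close>
  define D where "D = (1 - b) * ((1 + b)\<^sup>2 - a\<^sup>2) / 2"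
  define s where "s = (1 + b) * b\<^sup>2 + D"
  \<comment> \<open>The determinant of the quadratic form; its positivity makes \<open>T\<close>
    injective.\<close>
  define E where "E = (1 + b) * s - (a * b)\<^sup>2"
  define T :: "'a \<times> 'a \<Rightarrow> 'a \<times> 'a" where
    "T v = ((1 + b) *\<^sub>R fst v - (a * b) *\<^sub>R snd v, sqrt E *\<^sub>R snd v)" for v
  have b: "0 < 1 + b" "0 < 1 - b" using assms(1) by auto
  have "\<bar>a\<bar>\<^sup>2 < (1 + b)\<^sup>2"
    using assms(2) by (intro power_strict_mono) auto
  then have ab: "0 < (1 + b)\<^sup>2 - a\<^sup>2" by simp
  then have D: "0 < D" using b by (simp add: D_def)
  have "E = b\<^sup>2 * ((1 + b)\<^sup>2 - a\<^sup>2) + (1 + b) * D"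
    by (simp add: E_def s_def algebra_simps power2_eq_square)
  then have E: "0 < E" using ab b D
    by (simp add: add_nonneg_pos)
  have lin: "linear T"
    by (rule linearI) (auto simp: T_def algebra_simps)
  have "inj T"
    unfolding linear_injective_0[OF lin] using b E by (auto simp: T_def zero_prod_def)
  then obtain c where c: "0 < c" "\<And>v. c * norm v \<le> norm (T v)"
    using linear_inj_bounded_below_pos[OF lin] by blast
  obtain C where C: "0 < C" "\<And>v. norm (T v) \<le> C * norm v"
    using linear_bounded_pos[OF lin] by blast
  have sq: "(norm (T (x, y)))\<^sup>2
      = (1 + b) * ((1 + b) * (x \<bullet> x) - 2 * a * b * (x \<bullet> y) + s * (y \<bullet> y))" for x y
  proof -
    have "(norm (T (x, y)))\<^sup>2
      = (1 + b)\<^sup>2 * (x \<bullet> x) - 2 * ((1 + b) * (a * b)) * (x \<bullet> y) + ((a * b)\<^sup>2 + E) * (y \<bullet> y)"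
      unfolding power2_norm_eq_inner T_def inner_Pair fst_conv snd_conv using E
      by (simp add: inner_diff inner_commute algebra_simps power2_eq_square)
    then show ?thesis
      by (simp add: E_def power2_eq_square algebra_simps)
  qed
  have decr: "(norm (T (a *\<^sub>R x - b *\<^sub>R y, x)))\<^sup>2
      = (norm (T (x, y)))\<^sup>2 - (1 + b) * D * (norm (x, y))\<^sup>2" for x y
  proof -
    have "s = (1 + b) - a\<^sup>2 * (1 - b) - D"
      by (simp add: s_def D_def field_simps power2_eq_square)
    moreover have "s = (1 + b) * b\<^sup>2 + D" by (fact s_def)
    ultimately have e: "(1 + b) * a\<^sup>2 - 2 * a\<^sup>2 * b + s = (1 + b) - D"
      "(1 + b) * b\<^sup>2 = s - D"
      by (simp_all add: algebra_simps)
    have "(1 + b) * ((a *\<^sub>R x - b *\<^sub>R y) \<bullet> (a *\<^sub>R x - b *\<^sub>R y))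
        - 2 * a * b * ((a *\<^sub>R x - b *\<^sub>R y) \<bullet> x) + s * (x \<bullet> x)
      = ((1 + b) * a\<^sup>2 - 2 * a\<^sup>2 * b + s) * (x \<bullet> x) - 2 * a * b * (x \<bullet> y)
        + (1 + b) * b\<^sup>2 * (y \<bullet> y)"
      by (simp add: inner_diff inner_commute algebra_simps power2_eq_square)
    also have "\<dots> = (1 + b) * (x \<bullet> x) - 2 * a * b * (x \<bullet> y) + s * (y \<bullet> y)
        - D * (x \<bullet> x + y \<bullet> y)"
      unfolding e by (simp add: algebra_simps)
    finally show ?thesis
      unfolding sq by (simp add: norm_Pair power2_norm_eq_inner right_diff_distrib mult.assoc)
  qed
  define e where "e = (1 + b) * D"
  \<comment> \<open>The decrease is at least \<open>e / C^2\<close> times the squared norm of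
    \<open>T (x, y)\<close>. The squared factor \<open>1 - e / C^2\<close> is relaxed to
    \<open>C^2 / (C^2 + e)\<close>, which is visibly nonnegative and below 1.\<close>
  define \<sigma> where "\<sigma> = sqrt (C\<^sup>2 / (C\<^sup>2 + e))"
  have e: "0 < e" using b D by (simp add: e_def)
  have "norm (T (a *\<^sub>R x - b *\<^sub>R y, x)) \<le> \<sigma> * norm (T (x, y))" for x y
  proof (rule power2_le_imp_le)
    have "(norm (T (x, y)))\<^sup>2 \<le> C\<^sup>2 * (norm (x, y))\<^sup>2"
      using power_mono[OF C(2)[of "(x, y)"], of 2] by (simp add: power_mult_distrib)
    then have "e * (norm (T (x, y)))\<^sup>2 \<le> e * (C\<^sup>2 * (norm (x, y))\<^sup>2)"
      using e by simp
    then have "(C\<^sup>2 + e) * ((norm (T (x, y)))\<^sup>2 - e * (norm (x, y))\<^sup>2)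
        \<le> C\<^sup>2 * (norm (T (x, y)))\<^sup>2"
      using mult_nonneg_nonneg[of "e\<^sup>2" "(norm (x, y))\<^sup>2"]
      by (simp add: algebra_simps power2_eq_square)
    then have "(norm (T (x, y)))\<^sup>2 - e * (norm (x, y))\<^sup>2
        \<le> C\<^sup>2 * (norm (T (x, y)))\<^sup>2 / (C\<^sup>2 + e)"
      using e C(1) by (simp add: pos_le_divide_eq add_pos_pos mult.commute)
    then show "(norm (T (a *\<^sub>R x - b *\<^sub>R y, x)))\<^sup>2 \<le> (\<sigma> * norm (T (x, y)))\<^sup>2"
      using e C(1) unfolding decr e_def[symmetric]
      by (simp add: \<sigma>_def power_mult_distrib)
  qed (simp add: \<sigma>_def e less_imp_le)
  moreover have "\<sigma> < 1"
    using e C(1) by (simp add: \<sigma>_def add_pos_pos)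
  moreover have "0 \<le> \<sigma>" using e by (simp add: \<sigma>_def)
  moreover have "norm (T (v + w)) \<le> norm (T v) + norm (T w)" for v w
    by (simp add: linear_add[OF lin] norm_triangle_ineq)
  ultimately show thesis
    using c C by (intro that[of c C \<sigma> "\<lambda>v. norm (T v)"])
qed

section \<open>Planar trigonometry of the roots of unity and their images under
  \<open>M\<close>\<close>

lemma root_pt_nth [simp]:
  "root_pt K t $ 1 = cos (real t * theta K)" "root_pt K t $ 2 = sin (real t * theta K)"
  by (simp_all add: root_pt_def)

lemma vec2_eq_iff: "(v :: 'a^2) = w \<longleftrightarrow> v $ 1 = w $ 1 \<and> v $ 2 = w $ 2"
  by (simp add: vec_eq_iff forall_2)

lemma inner_vec2: "(v :: real^2) \<bullet> w = v $ 1 * w $ 1 + v $ 2 * w $ 2"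
  by (simp add: inner_vec_def sum_2)

lemma norm_root_pt [simp]: "norm (root_pt K t) = 1"
  by (simp add: norm_eq_sqrt_inner inner_vec2 flip: power2_eq_square)

text \<open>Allows the cycle to be indexed by all naturals, so that the error recursion has no case
  for the wrap-around.\<close>

lemma root_pt_mod:
  assumes "0 < K"
  shows "root_pt K (t mod K) = root_pt K t"
proof -
  have "real t = real (t mod K) + real (t div K) * real K"
    by (metis of_nat_add of_nat_mult mod_div_mult_eq)
  then have "real t * theta K = real (t mod K) * theta K + 2 * real (t div K) * pi"
    using assms by (simp add: theta_def field_simps)
  then show ?thesis
    by (simp add: vec2_eq_iff cos_add sin_add)
qed

lemma matrix_inv_rot:
  "matrix_inv (rot K) = vector [vector [cos (theta K), sin (theta K)],
                                vector [- sin (theta K), cos (theta K)]]" (is "_ = ?S")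
proof -
  have 1: "rot K ** ?S = mat 1" and 2: "?S ** rot K = mat 1"
    by (simp_all add: rot_def matrix_matrix_mult_def mat_def vec2_eq_iff sum_2
        flip: power2_eq_square)
  from 1 2 have "rot K ** matrix_inv (rot K) = mat 1 \<and> matrix_inv (rot K) ** rot K = mat 1"
    unfolding matrix_inv_def by (intro someI conjI)
  then have "?S ** (rot K ** matrix_inv (rot K)) = ?S"
    by (simp add: matrix_mul_rid)
  then show ?thesis
    by (simp add: matrix_mul_assoc 2 matrix_mul_lid)
qed

text \<open>Under the identification of the plane with \<open>\<complex>\<close>, \<open>M\<close> is multiplication by
  \<open>M_re - \<i> M_im\<close>.\<close>

definition M_re :: "nat \<Rightarrow> real \<Rightarrow> real \<Rightarrow> real \<Rightarrow> real \<Rightarrow> real" where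
  "M_re K \<mu> L \<gamma> \<beta> = ((1 + \<beta>) * (1 - cos (theta K)) - \<mu> * \<gamma>) / ((L - \<mu>) * \<gamma>)"

definition M_im :: "nat \<Rightarrow> real \<Rightarrow> real \<Rightarrow> real \<Rightarrow> real \<Rightarrow> real" where
  "M_im K \<mu> L \<gamma> \<beta> = (1 - \<beta>) * sin (theta K) / ((L - \<mu>) * \<gamma>)"

lemma M_mat_mult_vec_nth:
  "(M_mat K \<mu> L \<gamma> \<beta> *v v) $ 1 = M_re K \<mu> L \<gamma> \<beta> * v $ 1 + M_im K \<mu> L \<gamma> \<beta> * v $ 2"
  "(M_mat K \<mu> L \<gamma> \<beta> *v v) $ 2 = M_re K \<mu> L \<gamma> \<beta> * v $ 2 - M_im K \<mu> L \<gamma> \<beta> * v $ 1"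
  unfolding M_mat_def matrix_inv_rot
  by (simp_all add: M_re_def M_im_def rot_def matrix_vector_mult_def sum_2 mat_def
      add_divide_distrib diff_divide_distrib algebra_simps)

text \<open>The rotation and its inverse shift the index by one. The identity says that the cycle is
  an exact heavy-ball orbit when the gradient at a cycle point \<open>x\<close> is
  \<open>\<mu> x + (L - \<mu>) M x\<close>.\<close>

lemma M_mat_root_pt_Suc:
  assumes "\<mu> \<noteq> L" and "\<gamma> \<noteq> 0"
  shows "((L - \<mu>) * \<gamma>) *\<^sub>R (M_mat K \<mu> L \<gamma> \<beta> *v root_pt K (Suc t))
    = (1 + \<beta> - \<mu> * \<gamma>) *\<^sub>R root_pt K (Suc t) - root_pt K (Suc (Suc t)) - \<beta> *\<^sub>R root_pt K t"
proof -
  let ?a = "real (Suc t) * theta K"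
  have a: "real (Suc (Suc t)) * theta K = ?a + theta K" "real t * theta K = ?a - theta K"
    by (simp_all add: algebra_simps)
  show ?thesis
    unfolding vec2_eq_iff vector_scaleR_component vector_minus_component M_mat_mult_vec_nth
      root_pt_nth a cos_add sin_add cos_diff sin_diff
    using assms by (simp add: M_re_def M_im_def divide_simps) (simp add: algebra_simps)
qed

text \<open>With \<open>m = P - i Q\<close>, rotation invariance reduces the inner product to the
  real part of \<open>conj (1 - m) * m * (exp (2 i x) - 1)\<close>, where \<open>x\<close> is half
  the angle from point \<open>k\<close> to point \<open>j\<close>.\<close>

lemma inner_M_mat_root_pt:
  fixes j k K :: nat and \<mu> L \<gamma> \<beta> :: real
  defines "x \<equiv> (real j - real k) * (pi / real K)"
  defines "P \<equiv> M_re K \<mu> L \<gamma> \<beta>" and "Q \<equiv> M_im K \<mu> L \<gamma> \<beta>"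
  shows "(root_pt K k - M_mat K \<mu> L \<gamma> \<beta> *v root_pt K k)
      \<bullet> (M_mat K \<mu> L \<gamma> \<beta> *v root_pt K j - M_mat K \<mu> L \<gamma> \<beta> *v root_pt K k)
    = 2 * sin x * (Q * cos x - (P * (1 - P) - Q\<^sup>2) * sin x)" (is "?lhs = _")
proof -
  let ?a = "real k * theta K" and ?b = "real j * theta K"
  have "?b - ?a = 2 * x"
    by (simp add: x_def theta_def algebra_simps)
  then have c: "cos ?b * cos ?a + sin ?b * sin ?a = 1 - 2 * (sin x)\<^sup>2"
    and s: "sin ?b * cos ?a - cos ?b * sin ?a = 2 * sin x * cos x"
    using cos_diff[of ?b ?a] sin_diff[of ?b ?a] by (simp_all add: cos_double_sin sin_double)
  have "?lhs = (P * (1 - P) - Q\<^sup>2) * (cos ?b * cos ?a + sin ?b * sin ?a - 1)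
      + Q * (sin ?b * cos ?a - cos ?b * sin ?a)"
    unfolding inner_vec2 vector_minus_component M_mat_mult_vec_nth root_pt_nth
      P_def[symmetric] Q_def[symmetric]
    using sin_cos_squared_add[of ?a] by algebra
  then show ?thesis
    unfolding c s by (simp add: algebra_simps power2_eq_square)
qed

text \<open>A chord of the unit circle, scaled by the modulus of the complex number representing
  \<open>M\<close>.\<close>

lemma norm_M_mat_root_pt_diff:
  "norm (M_mat K \<mu> L \<gamma> \<beta> *v root_pt K j - M_mat K \<mu> L \<gamma> \<beta> *v root_pt K k)
    = 2 * sqrt ((M_re K \<mu> L \<gamma> \<beta>)\<^sup>2 + (M_im K \<mu> L \<gamma> \<beta>)\<^sup>2)
        * \<bar>sin ((real j - real k) * (pi / real K))\<bar>" (is "norm ?v = 2 * ?m * \<bar>sin ?x\<bar>")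
proof (rule power2_eq_imp_eq)
  let ?a = "real k * theta K" and ?b = "real j * theta K"
  let ?P = "M_re K \<mu> L \<gamma> \<beta>" and ?Q = "M_im K \<mu> L \<gamma> \<beta>"
  have "?b - ?a = 2 * ?x"
    by (simp add: theta_def algebra_simps)
  then have c: "cos ?b * cos ?a + sin ?b * sin ?a = 1 - 2 * (sin ?x)\<^sup>2"
    by (metis cos_diff cos_double_sin)
  have "(norm ?v)\<^sup>2 = (?P\<^sup>2 + ?Q\<^sup>2) * (2 - 2 * (cos ?b * cos ?a + sin ?b * sin ?a))"
    unfolding power2_norm_eq_inner inner_vec2 vector_minus_component M_mat_mult_vec_nth root_pt_nth
    using sin_cos_squared_add[of ?a] sin_cos_squared_add[of ?b] by algebra
  then show "(norm ?v)\<^sup>2 = (2 * ?m * \<bar>sin ?x\<bar>)\<^sup>2"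
    unfolding c by (simp add: power_mult_distrib)
qed simp_all

text \<open>Distinct indices keep the absolute half-angle between \<open>pi / K\<close> and
  \<open>pi - pi / K\<close>. This makes the adjacent vertices the extreme case in the projection
  test.\<close>

lemma abs_sin_cos_multiple_pi_div:
  fixes j k K :: nat
  assumes "j < K" "k < K" "j \<noteq> k"
  defines "x \<equiv> (real j - real k) * (pi / real K)"
  shows "\<bar>cos x\<bar> \<le> cos (pi / real K)" and "sin (pi / real K) \<le> \<bar>sin x\<bar>"
proof -
  let ?h = "pi / real K"
  have K: "2 \<le> K" using assms by linarith
  have pi: "pi = real K * ?h" using K by simp
  have "1 \<le> \<bar>real j - real k\<bar>" "\<bar>real j - real k\<bar> \<le> real K - 1"
    using assms by linarith+
  then have "1 * ?h \<le> \<bar>real j - real k\<bar> * ?h" "\<bar>real j - real k\<bar> * ?h \<le> (real K - 1) * ?h"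
    by (intro mult_right_mono; simp)+
  then have x: "?h \<le> \<bar>x\<bar>" "\<bar>x\<bar> \<le> pi - ?h"
    using pi unfolding x_def abs_mult by (simp, simp only: left_diff_distrib) auto
  have h: "0 \<le> ?h" "?h \<le> pi / 2" using K by (auto simp: field_simps)
  have "cos \<bar>x\<bar> \<le> cos ?h" "cos (pi - ?h) \<le> cos \<bar>x\<bar>"
    using x h by (intro cos_monotone_0_pi_le; linarith)+
  then show c: "\<bar>cos x\<bar> \<le> cos ?h" by (simp add: abs_le_iff)
  have "(cos x)\<^sup>2 \<le> (cos ?h)\<^sup>2"
    using power_mono[OF c, of 2] by simp
  then have "(sin ?h)\<^sup>2 \<le> \<bar>sin x\<bar>\<^sup>2"
    by (simp add: sin_squared_eq)
  then show "sin ?h \<le> \<bar>sin x\<bar>"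
    by (rule power2_le_imp_le) simp
qed

section \<open>The radius on which the projection onto the hull is constant\<close>

text \<open>The inner product formula for \<open>j = 1\<close>, \<open>k = 0\<close>, divided by the
  chord length. Multiplying by the modulus of \<open>M\<close> keeps the identity valid for
  \<open>M = 0\<close>, where both sides vanish.\<close>

lemma r_max_eq:
  fixes K :: nat and \<mu> L \<gamma> \<beta> :: real
  defines "P \<equiv> M_re K \<mu> L \<gamma> \<beta>" and "Q \<equiv> M_im K \<mu> L \<gamma> \<beta>" and "h \<equiv> pi / real K"
  assumes "2 \<le> K"
  shows "r_max K \<mu> L \<gamma> \<beta> * sqrt (P\<^sup>2 + Q\<^sup>2) = (P * (1 - P) - Q\<^sup>2) * sin h - Q * cos h"
proof -
  let ?M = "M_mat K \<mu> L \<gamma> \<beta>"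
  let ?u = "?M *v root_pt K 1 - ?M *v root_pt K 0"
  have "h < pi" using assms by (simp add: h_def field_simps)
  moreover have "0 < h" using assms by (simp add: h_def)
  ultimately have h: "0 < sin h" by (intro sin_gt_zero)
  have u: "norm ?u = 2 * sqrt (P\<^sup>2 + Q\<^sup>2) * sin h"
    using norm_M_mat_root_pt_diff[of K \<mu> L \<gamma> \<beta> 1 0] h by (simp add: P_def Q_def h_def)
  have "r_max K \<mu> L \<gamma> \<beta> = - ((root_pt K 0 - ?M *v root_pt K 0) \<bullet> ?u) / norm ?u"
    by (simp add: r_max_def Let_def matrix_vector_mult_diff_distrib matrix_vector_mult_diff_rdistrib)
  also have "(root_pt K 0 - ?M *v root_pt K 0) \<bullet> ?u
      = 2 * sin h * (Q * cos h - (P * (1 - P) - Q\<^sup>2) * sin h)"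
    using inner_M_mat_root_pt[of K 0 \<mu> L \<gamma> \<beta> 1] by (simp add: P_def Q_def h_def)
  finally have r: "r_max K \<mu> L \<gamma> \<beta>
      = - (2 * sin h * (Q * cos h - (P * (1 - P) - Q\<^sup>2) * sin h)) / norm ?u" .
  show ?thesis
  proof (cases "sqrt (P\<^sup>2 + Q\<^sup>2) = 0")
    case True
    then have "P = 0" "Q = 0" by (simp_all add: sum_power2_eq_zero_iff)
    then show ?thesis by simp
  next
    case False
    then show ?thesis using h unfolding r u by (simp add: field_simps)
  qed
qed

text \<open>Of the two edges of the hull at a vertex, \<open>r_max\<close> only tests the one towards the successor;
  since \<open>M_im \<ge> 0\<close>, this is the more restrictive one.\<close>

lemma closest_point_M_hull:
  assumes "2 \<le> K" "0 \<le> M_im K \<mu> L \<gamma> \<beta>" "k < K"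
    and z: "norm (z - root_pt K k) \<le> r_max K \<mu> L \<gamma> \<beta>"
  shows "closest_point (M_hull K \<mu> L \<gamma> \<beta>) z = M_mat K \<mu> L \<gamma> \<beta> *v root_pt K k"
proof -
  define P Q m h r where "P = M_re K \<mu> L \<gamma> \<beta>" and "Q = M_im K \<mu> L \<gamma> \<beta>"
    and "m = sqrt (P\<^sup>2 + Q\<^sup>2)" and "h = pi / real K" and "r = r_max K \<mu> L \<gamma> \<beta>"
  define A where "A = P * (1 - P) - Q\<^sup>2"
  note defs = P_def[symmetric] Q_def[symmetric] m_def[symmetric] h_def[symmetric] r_def[symmetric]
    A_def[symmetric]
  let ?M = "M_mat K \<mu> L \<gamma> \<beta>"
  let ?p = "?M *v root_pt K k"
  have rm: "r * m = A * sin h - Q * cos h"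
    using r_max_eq[OF assms(1), of \<mu> L \<gamma> \<beta>] unfolding defs .
  have r0: "0 \<le> r" using z norm_ge_zero order_trans unfolding r_def by blast
  have Q0: "0 \<le> Q" using assms(2) by (simp add: Q_def)
  have "0 < h" "h \<le> pi / 2" using assms(1) by (auto simp: h_def field_simps)
  then have h: "0 < sin h" "0 \<le> cos h"
    using pi_gt_zero by (auto intro!: sin_gt_zero cos_ge_zero)
  have m0: "0 \<le> m" by (simp add: m_def)
  \<comment> \<open>The hypothesis on \<open>z\<close> forces \<open>r\<close> to be nonnegative,
    hence also the sign of \<open>A\<close>.\<close>
  have "0 \<le> A * sin h"
    using rm mult_nonneg_nonneg[OF r0 m0] mult_nonneg_nonneg[OF Q0 h(2)] by linarith
  then have A0: "0 \<le> A" using h(1) by (simp add: zero_le_mult_iff)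
  \<comment> \<open>Split \<open>z - ?p\<close> at the cycle point: Cauchy-Schwarz bounds the first
    part through \<open>r * m\<close>, the explicit formula the second. The terms with
    \<open>Q\<close> cancel and a multiple of \<open>A * (sin h - \<bar>sin x\<bar>)\<close>
    remains.\<close>
  have vertex: "(z - ?p) \<bullet> (?M *v root_pt K j - ?p) \<le> 0" if "j < K" for j
  proof (cases "j = k")
    case False
    define x where "x = (real j - real k) * h"
    have x: "\<bar>cos x\<bar> \<le> cos h" "sin h \<le> \<bar>sin x\<bar>"
      using abs_sin_cos_multiple_pi_div[OF that \<open>k < K\<close> False] by (simp_all add: x_def h_def)
    have "(z - root_pt K k) \<bullet> (?M *v root_pt K j - ?p)
        \<le> norm (z - root_pt K k) * norm (?M *v root_pt K j - ?p)"
      by (rule norm_cauchy_schwarz)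
    also have "\<dots> \<le> r * (2 * m * \<bar>sin x\<bar>)"
      unfolding norm_M_mat_root_pt_diff defs x_def[symmetric]
      using z m0 unfolding defs by (intro mult_right_mono) auto
    finally have 1: "(z - root_pt K k) \<bullet> (?M *v root_pt K j - ?p) \<le> 2 * \<bar>sin x\<bar> * (r * m)"
      by (simp add: algebra_simps)
    have "sin x * cos x \<le> \<bar>sin x\<bar> * \<bar>cos x\<bar>"
      by (metis abs_ge_self abs_mult)
    also have "\<dots> \<le> \<bar>sin x\<bar> * cos h"
      using x(1) by (intro mult_left_mono) auto
    finally have "Q * (sin x * cos x) \<le> Q * (\<bar>sin x\<bar> * cos h)"
      using Q0 by (rule mult_left_mono)
    then have "(root_pt K k - ?p) \<bullet> (?M *v root_pt K j - ?p)
        \<le> 2 * \<bar>sin x\<bar> * (Q * cos h - A * \<bar>sin x\<bar>)"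
      unfolding inner_M_mat_root_pt defs x_def[symmetric]
      by (simp add: algebra_simps)
    with 1 have "(z - ?p) \<bullet> (?M *v root_pt K j - ?p)
        \<le> 2 * \<bar>sin x\<bar> * (A * (sin h - \<bar>sin x\<bar>))"
      unfolding rm by (simp add: algebra_simps inner_diff)
    also have "\<dots> \<le> 0"
      using A0 x(2) by (intro mult_nonneg_nonpos) auto
    finally show ?thesis .
  qed simp
  \<comment> \<open>A half-space containing all vertices contains the hull.\<close>
  have "M_hull K \<mu> L \<gamma> \<beta> \<subseteq> {y. (z - ?p) \<bullet> y \<le> (z - ?p) \<bullet> ?p}"
    unfolding M_hull_def
  proof (rule hull_minimal)
    show "convex {y. (z - ?p) \<bullet> y \<le> (z - ?p) \<bullet> ?p}"
      by (rule convex_halfspace_le)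
  qed (use vertex in \<open>auto simp: inner_diff_right\<close>)
  moreover have "?p \<in> M_hull K \<mu> L \<gamma> \<beta>"
    unfolding M_hull_def using \<open>k < K\<close> by (intro hull_inc) auto
  moreover have "closed (M_hull K \<mu> L \<gamma> \<beta>)"
    unfolding M_hull_def by (intro compact_imp_closed finite_imp_compact_convex_hull) simp
  ultimately show ?thesis
    by (intro closest_point_eqI) (auto simp: M_hull_def inner_diff_right convex_convex_hull)
qed

section \<open>The error recursion and the invariant ball\<close>

lemma grad_psi:
  assumes "0 < K"
  shows "grad (psi K \<mu> L \<gamma> \<beta>) x
    = \<mu> *\<^sub>R x + (L - \<mu>) *\<^sub>R closest_point (M_hull K \<mu> L \<gamma> \<beta>) x"
proof (rule grad_eq)
  let ?H = "M_hull K \<mu> L \<gamma> \<beta>"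
  have "convex ?H" "closed ?H" "?H \<noteq> {}"
    using assms unfolding M_hull_def
    by (auto intro!: compact_imp_closed finite_imp_compact_convex_hull)
  then have "((\<lambda>x. (infdist x ?H)\<^sup>2) has_derivative
      (\<lambda>h. h \<bullet> 2 *\<^sub>R (x - closest_point ?H x))) (at x)"
    using GDERIV_infdist_square unfolding gderiv_def by blast
  then have "((\<lambda>x. L / 2 * (x \<bullet> x) - (L - \<mu>) / 2 * (infdist x ?H)\<^sup>2) has_derivative
      (\<lambda>h. L / 2 * (x \<bullet> h + h \<bullet> x) - (L - \<mu>) / 2 * (h \<bullet> 2 *\<^sub>R (x - closest_point ?H x)))) (at x)"
    by (intro has_derivative_diff has_derivative_mult_right has_derivative_inner
        has_derivative_ident)
  moreover have "psi K \<mu> L \<gamma> \<beta> = (\<lambda>x. L / 2 * (x \<bullet> x) - (L - \<mu>) / 2 * (infdist x ?H)\<^sup>2)"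
    by (simp add: psi_def fun_eq_iff power2_norm_eq_inner)
  moreover have "(\<lambda>h. L / 2 * (x \<bullet> h + h \<bullet> x) - (L - \<mu>) / 2 * (h \<bullet> 2 *\<^sub>R (x - closest_point ?H x)))
      = (\<lambda>h. h \<bullet> (\<mu> *\<^sub>R x + (L - \<mu>) *\<^sub>R closest_point ?H x))"
    by (simp add: fun_eq_iff inner_simps inner_commute field_simps)
  ultimately show "GDERIV (psi K \<mu> L \<gamma> \<beta>) x :> \<mu> *\<^sub>R x + (L - \<mu>) *\<^sub>R closest_point ?H x"
    unfolding gderiv_def by simp
qed

text \<open>The budgets give
  \<open>\<bar>\<delta>\<gamma>\<bar> \<le> \<gamma> * \<eta> / 4\<close>,
  \<open>\<bar>\<delta>\<beta>\<bar> \<le> \<eta> / 2\<close> and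
  \<open>norm g \<le> L * \<eta> / 4\<close>. Since \<open>\<eta> \<le> 1\<close>, the perturbed
  step size is at most \<open>5 / 4 * \<gamma>\<close>, so the bound stays linear in
  \<open>\<eta>\<close>. The three summands come from momentum, step size and gradient
  error.\<close>

lemma perturbed_step_bound:
  assumes "0 < \<gamma>" "0 < L" "0 \<le> \<mu>" "0 \<le> r" "0 \<le> \<kappa>" "\<eta> \<le> 1"
    and d: "(4 / \<gamma> + \<mu> * \<kappa> * r) * \<bar>\<delta>\<gamma>\<bar> + (2 + 2 * \<kappa> * r) * \<bar>\<delta>\<beta>\<bar> \<le> \<eta>"
    and g: "4 / L * norm g \<le> \<eta>"
    and G: "norm G \<le> 4 / \<gamma> + \<mu> * r" and D: "norm D \<le> 2 + 2 * r"
  shows "norm (\<delta>\<beta> *\<^sub>R D - \<delta>\<gamma> *\<^sub>R G - (\<gamma> + \<delta>\<gamma>) *\<^sub>R g)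
    \<le> \<eta> * ((1 + r) + (1 + \<gamma> * \<mu> * r / 4) + 5 / 16 * \<gamma> * L)"
proof -
  have d': "4 / \<gamma> * \<bar>\<delta>\<gamma>\<bar> + \<mu> * \<kappa> * r * \<bar>\<delta>\<gamma>\<bar> + 2 * \<bar>\<delta>\<beta>\<bar> + 2 * \<kappa> * r * \<bar>\<delta>\<beta>\<bar> \<le> \<eta>"
    using d by (simp add: distrib_right)
  have "0 \<le> 4 / \<gamma> * \<bar>\<delta>\<gamma>\<bar>" "0 \<le> \<mu> * \<kappa> * r * \<bar>\<delta>\<gamma>\<bar>" "0 \<le> 2 * \<kappa> * r * \<bar>\<delta>\<beta>\<bar>"
    using assms by simp_all
  with d' have "4 / \<gamma> * \<bar>\<delta>\<gamma>\<bar> \<le> \<eta>" and \<delta>\<beta>: "\<bar>\<delta>\<beta>\<bar> \<le> \<eta> / 2"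
    by linarith+
  then have \<delta>\<gamma>: "\<bar>\<delta>\<gamma>\<bar> \<le> \<gamma> * \<eta> / 4" using \<open>0 < \<gamma>\<close> by (simp add: field_simps)
  have g': "norm g \<le> L * \<eta> / 4" using g \<open>0 < L\<close> by (simp add: field_simps)
  have "0 \<le> 4 / L * norm g" using \<open>0 < L\<close> by simp
  then have \<eta>: "0 \<le> \<eta>" using g by linarith
  have "\<bar>\<gamma> + \<delta>\<gamma>\<bar> \<le> \<gamma> + \<gamma> * \<eta> / 4" using \<delta>\<gamma> \<open>0 < \<gamma>\<close> by linarith
  also have "\<dots> \<le> \<gamma> + \<gamma> * 1 / 4"
    using \<open>0 < \<gamma>\<close> \<open>\<eta> \<le> 1\<close> by simp
  finally have \<gamma>: "\<bar>\<gamma> + \<delta>\<gamma>\<bar> \<le> 5 / 4 * \<gamma>" by simp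
  have "norm (\<delta>\<beta> *\<^sub>R D - \<delta>\<gamma> *\<^sub>R G - (\<gamma> + \<delta>\<gamma>) *\<^sub>R g)
      \<le> \<bar>\<delta>\<beta>\<bar> * norm D + \<bar>\<delta>\<gamma>\<bar> * norm G + \<bar>\<gamma> + \<delta>\<gamma>\<bar> * norm g"
    by (intro norm_triangle_le_diff add_mono) simp_all
  also have "\<dots> \<le> \<eta> / 2 * (2 + 2 * r) + \<gamma> * \<eta> / 4 * (4 / \<gamma> + \<mu> * r) + 5 / 4 * \<gamma> * (L * \<eta> / 4)"
    using \<delta>\<beta> \<delta>\<gamma> \<gamma> g' G D \<eta> \<open>0 < \<gamma>\<close> by (intro add_mono mult_mono) auto
  also have "\<dots> = \<eta> * ((1 + r) + (1 + \<gamma> * \<mu> * r / 4) + 5 / 16 * \<gamma> * L)"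
    using \<open>0 < \<gamma>\<close> by (simp add: field_simps)
  finally show ?thesis .
qed

text \<open>Subtracting the exact orbit leaves the homogeneous recursion for the deviations; every
  perturbation is collected in \<open>w\<close>.\<close>

lemma perturbed_HB_error_step:
  fixes z \<delta>g :: "nat \<Rightarrow> real^2" and \<delta>\<gamma> \<delta>\<beta> :: "nat \<Rightarrow> real" and K :: nat
  defines "e \<equiv> \<lambda>t. z t - root_pt K t"
  assumes "0 < \<mu>" "\<mu> < L" "2 \<le> K" "(\<gamma>, \<beta>) \<in> Omega_cv L" "0 \<le> \<kappa>" "\<eta> \<le> 1"
    and r: "r = r_max K \<mu> L \<gamma> \<beta>"
    and HB: "perturbed_HB \<gamma> \<beta> (psi K \<mu> L \<gamma> \<beta>) \<delta>\<gamma> \<delta>\<beta> \<delta>g z"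
    and V: "closest_point (M_hull K \<mu> L \<gamma> \<beta>) (z (Suc t)) = M_mat K \<mu> L \<gamma> \<beta> *v root_pt K (Suc t)"
    and e: "norm (e t) \<le> r" "norm (e (Suc t)) \<le> r"
    and d: "(4 / \<gamma> + \<mu> * \<kappa> * r) * \<bar>\<delta>\<gamma> (Suc t)\<bar> + (2 + 2 * \<kappa> * r) * \<bar>\<delta>\<beta> (Suc t)\<bar> \<le> \<eta>"
    and g: "4 / L * norm (\<delta>g (Suc t)) \<le> \<eta>"
  obtains w where "e (Suc (Suc t)) = (1 + \<beta> - \<mu> * \<gamma>) *\<^sub>R e (Suc t) - \<beta> *\<^sub>R e t + w"
    "norm w \<le> \<eta> * ((1 + r) + (1 + \<gamma> * \<mu> * r / 4) + 5 / 16 * \<gamma> * L)"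
proof -
  have \<gamma>: "0 < \<gamma>" and \<beta>: "- 1 < \<beta>" "\<beta> < 1"
    using assms(5) by (auto simp: Omega_cv_def)
  have r0: "0 \<le> r" using e(1) norm_ge_zero order_trans by blast
  define x where "x = root_pt K"
  \<comment> \<open>By \<open>V\<close>, this is the exact gradient of \<psi> at the current
    iterate.\<close>
  define G where "G = \<mu> *\<^sub>R z (Suc t) + (L - \<mu>) *\<^sub>R (M_mat K \<mu> L \<gamma> \<beta> *v x (Suc t))"
  define D where "D = z (Suc t) - z t"
  let ?w = "\<delta>\<beta> (Suc t) *\<^sub>R D - \<delta>\<gamma> (Suc t) *\<^sub>R G - (\<gamma> + \<delta>\<gamma> (Suc t)) *\<^sub>R \<delta>g (Suc t)"
  have z: "z s = x s + e s" for s
    by (simp add: e_def x_def)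
  have M: "((L - \<mu>) * \<gamma>) *\<^sub>R (M_mat K \<mu> L \<gamma> \<beta> *v x (Suc t))
      = (1 + \<beta> - \<mu> * \<gamma>) *\<^sub>R x (Suc t) - x (Suc (Suc t)) - \<beta> *\<^sub>R x t"
    unfolding x_def using M_mat_root_pt_Suc[of \<mu> L \<gamma> K \<beta> t] \<open>\<mu> < L\<close> \<gamma> by simp
  have "\<gamma> *\<^sub>R G = (\<mu> * \<gamma>) *\<^sub>R z (Suc t)
      + ((L - \<mu>) * \<gamma>) *\<^sub>R (M_mat K \<mu> L \<gamma> \<beta> *v x (Suc t))"
    by (simp add: G_def scaleR_add_right mult.commute)
  then have \<gamma>G: "\<gamma> *\<^sub>R G
      = (1 + \<beta>) *\<^sub>R x (Suc t) - x (Suc (Suc t)) - \<beta> *\<^sub>R x t + (\<mu> * \<gamma>) *\<^sub>R e (Suc t)"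
    unfolding M z by (simp add: algebra_simps)
  have "z (Suc (Suc t)) = z (Suc t) - (\<gamma> + \<delta>\<gamma> (Suc t)) *\<^sub>R (G + \<delta>g (Suc t))
      + (\<beta> + \<delta>\<beta> (Suc t)) *\<^sub>R D"
    using HB \<open>2 \<le> K\<close> V unfolding perturbed_HB_def
    by (auto simp: grad_psi G_def D_def x_def dest!: spec[of _ "Suc t"])
  also have "\<dots> = z (Suc t) + \<beta> *\<^sub>R D - \<gamma> *\<^sub>R G + ?w"
    by (simp add: algebra_simps)
  also have "\<dots> = x (Suc (Suc t)) + ((1 + \<beta> - \<mu> * \<gamma>) *\<^sub>R e (Suc t) - \<beta> *\<^sub>R e t + ?w)"
    unfolding \<gamma>G by (simp add: D_def z algebra_simps)
  finally have step: "e (Suc (Suc t)) = (1 + \<beta> - \<mu> * \<gamma>) *\<^sub>R e (Suc t) - \<beta> *\<^sub>R e t + ?w"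
    unfolding z[of "Suc (Suc t)"] by simp
  \<comment> \<open>The three cycle points contribute at most 2 + 1 + 1, which is the 4 in
    \<open>4 / \<gamma>\<close>.\<close>
  have "norm (\<gamma> *\<^sub>R G) \<le> \<bar>1 + \<beta>\<bar> + 1 + \<bar>\<beta>\<bar> + \<mu> * \<gamma> * r"
    unfolding \<gamma>G using e(2) \<gamma> \<open>0 < \<mu>\<close>
    by (intro norm_triangle_le norm_triangle_le_diff add_mono) (simp_all add: x_def)
  also have "\<dots> \<le> 4 + \<mu> * \<gamma> * r" using \<beta> by auto
  finally have "norm G \<le> 4 / \<gamma> + \<mu> * r" using \<gamma> by (simp add: field_simps)
  moreover have "norm D \<le> norm (x (Suc t)) + norm (x t) + (norm (e (Suc t)) + norm (e t))"
    unfolding D_def z add_diff_add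
    by (intro norm_triangle_le add_mono norm_triangle_ineq4)
  then have "norm D \<le> 2 + 2 * r"
    using e by (simp add: x_def)
  ultimately have "norm ?w \<le> \<eta> * ((1 + r) + (1 + \<gamma> * \<mu> * r / 4) + 5 / 16 * \<gamma> * L)"
    using \<gamma> r0 assms by (intro perturbed_step_bound[where \<kappa> = \<kappa>]) auto
  with step show thesis by (rule that)
qed

theorem theorem4p3:
  fixes \<mu> L \<gamma> \<beta> :: real and K :: nat
  assumes "0 < \<mu>" and "\<mu> < L" and "2 \<le> K"
    and "(\<gamma>, \<beta>) \<in> Omega_circ K \<mu> L"
  shows "\<exists>\<kappa> \<rho> :: real. 0 < \<kappa> \<and> \<rho> < 1 \<and>
    (\<forall>(\<delta>0 :: real^2) (\<delta>1 :: real^2) (\<delta>\<gamma> :: nat \<Rightarrow> real) (\<delta>\<beta> :: nat \<Rightarrow> real)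
      (\<delta>g :: nat \<Rightarrow> real^2) (z :: nat \<Rightarrow> real^2).
      z 0 = root_pt K 0 + \<delta>0 \<longrightarrow>
      z 1 = root_pt K 1 + \<delta>1 \<longrightarrow>
      perturbed_HB \<gamma> \<beta> (psi K \<mu> L \<gamma> \<beta>) \<delta>\<gamma> \<delta>\<beta> \<delta>g z \<longrightarrow>
      sqrt ((norm \<delta>0)\<^sup>2 + (norm \<delta>1)\<^sup>2) \<le> \<kappa> * r_max K \<mu> L \<gamma> \<beta> \<longrightarrow>
      (\<forall>t. (4 / \<gamma> + \<mu> * \<kappa> * r_max K \<mu> L \<gamma> \<beta>) * \<bar>\<delta>\<gamma> t\<bar>
           + (2 + 2 * \<kappa> * r_max K \<mu> L \<gamma> \<beta>) * \<bar>\<delta>\<beta> t\<bar>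
         \<le> 1 / 2 * (1 - \<rho>) * \<kappa> * r_max K \<mu> L \<gamma> \<beta>) \<longrightarrow>
      (\<forall>t. 4 / L * norm (\<delta>g t) \<le> 1 / 2 * (1 - \<rho>) * \<kappa> * r_max K \<mu> L \<gamma> \<beta>) \<longrightarrow>
      (\<forall>t. norm (z t - root_pt K (t mod K)) \<le> r_max K \<mu> L \<gamma> \<beta> \<and>
           z t \<in> V_nbhd K \<mu> L \<gamma> \<beta> (t mod K)))"
proof (cases "r_max K \<mu> L \<gamma> \<beta> < 0")
  case True
  have "\<not> sqrt ((norm (\<delta>0 :: real^2))\<^sup>2 + (norm (\<delta>1 :: real^2))\<^sup>2) \<le> 1 * r_max K \<mu> L \<gamma> \<beta>"
    for \<delta>0 \<delta>1
    using True by (simp add: not_le less_le_trans[OF _ real_sqrt_ge_zero])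
  then show ?thesis
    by (intro exI[of _ 1] exI[of _ 0]) auto
next
  case False
  define r where "r = r_max K \<mu> L \<gamma> \<beta>"
  have r0: "0 \<le> r" using False by (simp add: r_def)
  have \<Omega>: "(\<gamma>, \<beta>) \<in> Omega_cv L" using assms(4) by (simp add: Omega_circ_def)
  then have \<gamma>: "0 < \<gamma>" and \<beta>: "- 1 < \<beta>" "\<beta> < 1" and "\<gamma> < 2 / L * (1 + \<beta>)"
    by (auto simp: Omega_cv_def)
  then have "L * \<gamma> < 2 * (1 + \<beta>)" using assms by (simp add: field_simps)
  moreover have "\<mu> * \<gamma> < L * \<gamma>" "0 < \<mu> * \<gamma>" using assms \<gamma> by simp_all
  ultimately have "0 < \<mu> * \<gamma>" "\<mu> * \<gamma> < 2 + 2 * \<beta>" by auto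
  then have "\<bar>1 + \<beta> - \<mu> * \<gamma>\<bar> < 1 + \<beta>" by auto
  moreover have "\<bar>\<beta>\<bar> < 1" using \<beta> by auto
  ultimately obtain N :: "(real^2) \<times> (real^2) \<Rightarrow> real" and c C \<sigma> where
    c: "0 < c" "\<And>v. c * norm v \<le> N v" and C: "0 < C" "\<And>v. N v \<le> C * norm v" and
    \<sigma>: "\<sigma> < 1" "0 \<le> \<sigma>" "\<And>x y. N ((1 + \<beta> - \<mu> * \<gamma>) *\<^sub>R x - \<beta> *\<^sub>R y, x) \<le> \<sigma> * N (x, y)" and
    tri: "\<And>v w. N (v + w) \<le> N v + N w"
    using contracting_norm_exists by metis
  define B where "B = (1 + r) + (1 + \<gamma> * \<mu> * r / 4) + 5 / 16 * \<gamma> * L"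
  \<comment> \<open>Puts the initial pair of deviations into the \<open>N\<close>-ball of radius
    \<open>c * r\<close>, which lies in the Euclidean ball of radius \<open>r\<close>.\<close>
  define \<kappa> where "\<kappa> = c / C"
  \<comment> \<open>The tolerance is \<open>h * r\<close>. The first entry keeps it at most 1; the
    second makes one step's noise, measured in \<open>N\<close>, fit into the gap
    \<open>(1 - \<sigma>) * (c * r)\<close> left by the contraction.\<close>
  define h where "h = min (1 / (1 + r)) ((1 - \<sigma>) * c / (C * B))"
  \<comment> \<open>Solved from \<open>1 / 2 * (1 - \<rho>) * \<kappa> = h\<close>, which turns the
    right-hand sides of the hypotheses into \<open>h * r\<close>.\<close>
  define \<rho> where "\<rho> = 1 - 2 * h / \<kappa>"
  have "0 \<le> \<gamma> * \<mu> * r" "0 \<le> \<gamma> * L" using \<gamma> assms r0 by simp_all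
  then have B: "0 < B" unfolding B_def using r0 by simp
  have \<kappa>: "0 < \<kappa>" using c(1) C(1) by (simp add: \<kappa>_def)
  have h: "0 < h" using r0 \<sigma>(1) c(1) C(1) B by (simp add: h_def)
  have \<rho>: "1 / 2 * (1 - \<rho>) * \<kappa> = h" "\<rho> < 1" using \<kappa> h by (simp_all add: \<rho>_def)
  have "h * r \<le> 1 / (1 + r) * r" using r0 by (intro mult_right_mono) (simp_all add: h_def)
  also have "\<dots> \<le> 1" using r0 by (simp add: divide_simps)
  finally have \<eta>: "h * r \<le> 1" .
  have "h \<le> (1 - \<sigma>) * c / (C * B)" by (simp add: h_def)
  then have "C * (h * B) \<le> (1 - \<sigma>) * c" using B C(1) by (simp add: field_simps)
  then have hB: "C * (h * r * B) \<le> (1 - \<sigma>) * (c * r)"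
    using mult_right_mono[OF _ r0] by (fastforce simp: algebra_simps)
  have Q: "0 \<le> M_im K \<mu> L \<gamma> \<beta>"
    using assms \<gamma> \<beta> unfolding M_im_def theta_def
    by (intro divide_nonneg_nonneg mult_nonneg_nonneg sin_ge_zero) (simp_all add: field_simps)
  have K: "0 < K" using assms by simp
  have V: "closest_point (M_hull K \<mu> L \<gamma> \<beta>) y = M_mat K \<mu> L \<gamma> \<beta> *v root_pt K t"
    if "norm (y - root_pt K t) \<le> r" for y t
    using closest_point_M_hull[OF \<open>2 \<le> K\<close> Q, of "t mod K" y] that K
    by (simp add: root_pt_mod r_def)
  \<comment> \<open>As \<open>r\<close> is nonnegative, the ball contains its centre, so
    \<open>y\<close> and the cycle point have the same projection.\<close>
  have V_nbhd: "y \<in> V_nbhd K \<mu> L \<gamma> \<beta> (t mod K)" if "norm (y - root_pt K t) \<le> r" for y t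
    using V[OF that] V[of "root_pt K t" t] r0 K by (simp add: V_nbhd_def root_pt_mod)
  have bound: "norm (z t - root_pt K t) \<le> r"
    if z: "z 0 = root_pt K 0 + \<delta>0" "z 1 = root_pt K 1 + \<delta>1"
    and HB: "perturbed_HB \<gamma> \<beta> (psi K \<mu> L \<gamma> \<beta>) \<delta>\<gamma> \<delta>\<beta> \<delta>g z"
    and init: "sqrt ((norm \<delta>0)\<^sup>2 + (norm \<delta>1)\<^sup>2) \<le> \<kappa> * r"
    and d: "\<And>t. (4 / \<gamma> + \<mu> * \<kappa> * r) * \<bar>\<delta>\<gamma> t\<bar> + (2 + 2 * \<kappa> * r) * \<bar>\<delta>\<beta> t\<bar> \<le> h * r"
    and g: "\<And>t. 4 / L * norm (\<delta>g t) \<le> h * r"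
    for \<delta>0 \<delta>1 :: "real^2" and \<delta>\<gamma> \<delta>\<beta> :: "nat \<Rightarrow> real" and \<delta>g z :: "nat \<Rightarrow> real^2" and t
  proof -
    define e where "e t = z t - root_pt K t" for t
    have le_r: "norm (e t) \<le> r" "norm (e (Suc t)) \<le> r" if "N (e (Suc t), e t) \<le> c * r" for t
    proof -
      have "c * norm (e (Suc t), e t) \<le> c * r" using c(2) that by (rule order_trans)
      then have "norm (e (Suc t), e t) \<le> r" using c(1) by simp
      then show "norm (e t) \<le> r" "norm (e (Suc t)) \<le> r"
        using norm_fst_le[of "e (Suc t)" "e t"] norm_snd_le[of "e t" "e (Suc t)"] by linarith+
    qed
    \<comment> \<open>The \<open>N\<close>-ball is the invariant: it bounds both deviations by
      \<open>r\<close>, so the next iterate is computed where the gradient is affine, and the noise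
      enters only as \<open>(w, 0)\<close>.\<close>
    have inv: "N (e (Suc t), e t) \<le> c * r" for t
    proof (induction t)
      case 0
      have "norm (e (Suc 0), e 0) \<le> \<kappa> * r"
        using init z by (simp add: e_def norm_Pair add.commute)
      then have "C * norm (e (Suc 0), e 0) \<le> C * (\<kappa> * r)" using C(1) by simp
      then show ?case using C(2)[of "(e (Suc 0), e 0)"] C(1) by (simp add: \<kappa>_def)
    next
      case (Suc t)
      note e = le_r[OF Suc.IH, unfolded e_def]
      obtain w where w: "e (Suc (Suc t)) = (1 + \<beta> - \<mu> * \<gamma>) *\<^sub>R e (Suc t) - \<beta> *\<^sub>R e t + w"
        "norm w \<le> h * r * B"
        using perturbed_HB_error_step[OF assms(1,2,3) \<Omega> less_imp_le[OF \<kappa>] \<eta> r_def HB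
            V[OF e(2)] e d g] unfolding e_def B_def by blast
      have "N (e (Suc (Suc t)), e (Suc t))
          \<le> N ((1 + \<beta> - \<mu> * \<gamma>) *\<^sub>R e (Suc t) - \<beta> *\<^sub>R e t, e (Suc t)) + N (w, 0)"
        using tri[of "((1 + \<beta> - \<mu> * \<gamma>) *\<^sub>R e (Suc t) - \<beta> *\<^sub>R e t, e (Suc t))" "(w, 0)"]
        by (simp add: w(1))
      also have "\<dots> \<le> \<sigma> * N (e (Suc t), e t) + C * norm w"
        using \<sigma>(3) C(2)[of "(w, 0)"] by (intro add_mono) (simp_all add: norm_Pair)
      also have "\<dots> \<le> \<sigma> * (c * r) + C * (h * r * B)"
        using Suc.IH w(2) \<sigma>(2) C(1) by (intro add_mono mult_left_mono) auto
      also have "\<dots> \<le> c * r" using hB by (simp add: algebra_simps)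
      finally show ?case .
    qed
    show ?thesis using le_r(1)[OF inv] by (simp add: e_def)
  qed
  show ?thesis
  proof (rule exI[of _ \<kappa>], rule exI[of _ \<rho>], intro conjI allI impI)
    fix \<delta>0 \<delta>1 :: "real^2" and \<delta>\<gamma> \<delta>\<beta> :: "nat \<Rightarrow> real" and \<delta>g z :: "nat \<Rightarrow> real^2" and t
    assume "z 0 = root_pt K 0 + \<delta>0" "z 1 = root_pt K 1 + \<delta>1"
      "perturbed_HB \<gamma> \<beta> (psi K \<mu> L \<gamma> \<beta>) \<delta>\<gamma> \<delta>\<beta> \<delta>g z"
      "sqrt ((norm \<delta>0)\<^sup>2 + (norm \<delta>1)\<^sup>2) \<le> \<kappa> * r_max K \<mu> L \<gamma> \<beta>"
      "\<forall>t. (4 / \<gamma> + \<mu> * \<kappa> * r_max K \<mu> L \<gamma> \<beta>) * \<bar>\<delta>\<gamma> t\<bar>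
          + (2 + 2 * \<kappa> * r_max K \<mu> L \<gamma> \<beta>) * \<bar>\<delta>\<beta> t\<bar>
        \<le> 1 / 2 * (1 - \<rho>) * \<kappa> * r_max K \<mu> L \<gamma> \<beta>"
      "\<forall>t. 4 / L * norm (\<delta>g t) \<le> 1 / 2 * (1 - \<rho>) * \<kappa> * r_max K \<mu> L \<gamma> \<beta>"
    then have "norm (z t - root_pt K t) \<le> r"
      unfolding \<rho>(1) r_def[symmetric] by (intro bound) auto
    then show "norm (z t - root_pt K (t mod K)) \<le> r_max K \<mu> L \<gamma> \<beta>"
      and "z t \<in> V_nbhd K \<mu> L \<gamma> \<beta> (t mod K)"
      using V_nbhd K by (simp_all add: root_pt_mod r_def)
  qed (use \<kappa> \<rho> in auto)
qed

end
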